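(* There exists a strictly increasing sequence $(n_k)_{k\ge1}$ of positive integers such that the set $$G_2((n_k))=\Bigl\{\lambda\in\mathbb{T} : \sum_{k\ge1}|\lambda^{n_k}-1|^2<+\infty\Bigr\}$$ is uncountable, but no continuous probability measure on $\mathbb{T}$ is IP-Dirichlet with respect to $(n_k)_{k\ge1}$.
   Context: $\mathbb{T}=\{\lambda\in\mathbb{C}: |\lambda|=1\}$. For a Borel probability measure $\mu$ on $\mathbb{T}$ and $n\in\mathbb{Z}$, $\hat\mu(n)=\int_{\mathbb{T}}\lambda^n\,d\mu(\lambda)$. A measure is continuous if it has no atoms. Let $\mathcal{F}$ be the set of all non-empty finite subsets of $\mathbb{N}=\{1,2,\dots\}$. A probability measure $\mu$ on $\mathbb{T}$ is IP-Dirichlet with respect to $(n_k)_{k\ge1}$ if $\hat\mu(\sum_{k\in F}n_k)\to 1$ as $\min(F)\to+\infty$, $F\in\mathcal{F}$; that is, for every $\varepsilon>0$ there exists $k_0$ such that $|\hat\mu(\sum_{k\in F}n_k)-1|<\varepsilon$ for every $F\in\mathcal{F}$ with $\min(F)\ge k_0$. *)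

theory Defs
  imports "HOL-Probability.Probability"
begin

abbreviation unit_circle :: "complex set" where
  "unit_circle \<equiv> sphere 0 1"

definition circle_prob :: "complex measure \<Rightarrow> bool" where
  "circle_prob \<mu> \<longleftrightarrow> prob_space \<mu> \<and> sets \<mu> = sets (restrict_space borel unit_circle)"

definition continuous_measure :: "complex measure \<Rightarrow> bool" where
  "continuous_measure \<mu> \<longleftrightarrow> (\<forall>z\<in>space \<mu>. emeasure \<mu> {z} = 0)"

text \<open>The exponent carries no minus sign: the coefficient at \<open>m\<close> integrates \<open>z\<^sup>m\<close>.\<close>

definition fourier_coeff :: "complex measure \<Rightarrow> int \<Rightarrow> complex" where
  "fourier_coeff \<mu> m = (\<integral>z. z powi m \<partial>\<mu>)"

text \<open>Sequences are indexed by the positive integers; the value at \<open>0\<close> is never used.\<close>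

definition IP_Dirichlet :: "(nat \<Rightarrow> nat) \<Rightarrow> complex measure \<Rightarrow> bool" where
  "IP_Dirichlet n \<mu> \<longleftrightarrow>
     (\<forall>\<epsilon>>0. \<exists>k\<^sub>0. \<forall>F. finite F \<and> F \<noteq> {} \<and> F \<subseteq> {1..} \<and> Min F \<ge> k\<^sub>0 \<longrightarrow>
        cmod (fourier_coeff \<mu> (int (\<Sum>k\<in>F. n k)) - 1) < \<epsilon>)"

text \<open>The series over \<open>k \<ge> 1\<close> is written with the index shifted to start at \<open>0\<close>.\<close>

definition G2 :: "(nat \<Rightarrow> nat) \<Rightarrow> complex set" where
  "G2 n = {z \<in> unit_circle. summable (\<lambda>k. (cmod (z ^ n (Suc k) - 1))\<^sup>2)}"

end

theory Submission
  imports Defs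
begin

text \<open>
  Let \<open>q\<^sub>0 = 1\<close>, \<open>q\<^bsub>p+1\<^esub> = t\<^sub>p q\<^sub>p\<close> and let the sequence consist of the multiples
  \<open>q\<^sub>p, 2 q\<^sub>p, \<dots>, r\<^sub>p q\<^sub>p\<close> for all \<open>p\<close>, where \<open>r\<^sub>p\<close> grows geometrically and \<open>t\<^sub>p = r\<^sub>p\<^sup>2 / 16\<close>.
  If \<open>z = exp (2 \<pi> i \<Sum>\<^bsub>l \<in> A\<^esub> 1 / q\<^bsub>l+1\<^esub>)\<close>, then \<open>\<bar>z^(i q\<^sub>p) - 1\<bar>\<close> is of order \<open>i / t\<^sub>p\<close>, so block \<open>p\<close>
  contributes at most of the order \<open>r\<^sub>p\<^sup>3 / t\<^sub>p\<^sup>2\<close>, that is \<open>1 / r\<^sub>p\<close>, to the square sum.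

  On the other hand, every \<open>j q\<^sub>p\<close> with \<open>j < 8 t\<^sub>p\<close> is a subset sum of block \<open>p\<close>. Averaging the
  IP-Dirichlet condition over independent uniform choices of \<open>j\<close> in each block \<open>p \<ge> P\<close> shows that the
  product of the averages of \<open>z^(j q\<^sub>p)\<close> has integral close to \<open>1\<close>. One factor is at most \<open>1/2\<close> in
  modulus as soon as \<open>\<bar>z^q\<^sub>p - 1\<bar> \<ge> 1 / (2 t\<^sub>p)\<close> for some \<open>p \<ge> P\<close>; hence with large probability this
  happens for no \<open>p \<ge> P\<close>. But then \<open>\<bar>z^q\<^sub>p - 1\<bar>\<close> at least doubles with every step of \<open>p\<close>, so it
  vanishes, and \<open>z\<close> is one of finitely many roots of unity.
\<close>

section \<open>Subset sums and estimates for powers of unimodular numbers\<close>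

lemma subset_sum_atLeastAtMost:
  fixes j r :: nat
  assumes "j \<le> \<Sum>{1..r}"
  shows "\<exists>F\<subseteq>{1..r}. \<Sum>F = j"
  using assms
proof (induction r arbitrary: j)
  case 0
  then show ?case by auto
next
  case (Suc r)
  show ?case
  proof (cases "j \<le> \<Sum>{1..r}")
    case True
    then obtain F where "F \<subseteq> {1..r}" "\<Sum>F = j" using Suc.IH by blast
    then show ?thesis by (intro exI[of _ F]) auto
  next
    case False
    \<comment> \<open>Greedy choice: \<open>j\<close> exceeds the sum of the smaller numbers, hence
      exceeds \<open>r\<close>, so \<open>Suc r\<close> can be taken out of it.\<close>
    have "r \<le> \<Sum>{1..r}" by (induction r) auto
    then have "j - Suc r \<le> \<Sum>{1..r}" "Suc r \<le> j" using False Suc.prems by auto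
    then obtain F where F: "F \<subseteq> {1..r}" "\<Sum>F = j - Suc r" using Suc.IH by blast
    then have "finite F" "Suc r \<notin> F" using finite_subset by auto
    then have "\<Sum>(insert (Suc r) F) = j" using F \<open>Suc r \<le> j\<close> by simp
    then show ?thesis using F by (intro exI[of _ "insert (Suc r) F"]) auto
  qed
qed

text \<open>Every \<open>z ^ i\<close> with \<open>i < t\<close> is within 1/2 of 1, so the
  geometric sum, the cofactor of \<open>z - 1\<close> in \<open>z ^ t - 1\<close>, has modulus at
  least \<open>t / 2\<close>.\<close>

lemma cmod_power_minus_1_ge:
  fixes z :: complex
  assumes z: "cmod z = 1" and small: "cmod (z - 1) \<le> 1 / (2 * real t)" and t: "t \<ge> 1"
  shows "real t / 2 * cmod (z - 1) \<le> cmod (z ^ t - 1)"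
proof -
  have "cmod ((\<Sum>i<t. z ^ i) - of_nat t) = cmod (\<Sum>i<t. z ^ i - 1)"
    by (simp add: sum_subtractf)
  also have "\<dots> \<le> (\<Sum>i<t. 1 / 2)"
  proof (rule sum_norm_le)
    fix i assume i: "i \<in> {..<t}"
    have "cmod (z ^ i - 1) \<le> real i * cmod (z - 1)"
      using norm_power_diff[of z 1 i] z by simp
    also have "\<dots> \<le> real t * (1 / (2 * real t))"
      using i small by (intro mult_mono) auto
    finally show "cmod (z ^ i - 1) \<le> 1 / 2" using t by simp
  qed
  finally have "real t / 2 \<le> cmod (\<Sum>i<t. z ^ i)"
    using norm_triangle_ineq2[of "of_nat t" "of_nat t - (\<Sum>i<t. z ^ i)"]
    by (simp add: norm_minus_commute)
  moreover have "z ^ t - 1 = (z - 1) * (\<Sum>i<t. z ^ i)"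
    by (rule power_diff_1_eq)
  ultimately show ?thesis
    using mult_left_mono[of "real t / 2" _ "cmod (z - 1)"]
    by (simp add: norm_mult mult.commute[of _ "cmod (z - 1)"])
qed

lemma cmod_geometric_sum_le:
  fixes z :: complex
  assumes z: "cmod z = 1" and far: "4 \<le> real J * cmod (z - 1)"
  shows "cmod (\<Sum>j<J. z ^ j) \<le> real J / 2"
proof -
  have "cmod (z - 1) * cmod (\<Sum>j<J. z ^ j) = cmod (z ^ J - 1)"
    by (simp add: power_diff_1_eq norm_mult)
  also have "\<dots> \<le> 2"
    using norm_triangle_ineq4[of "z ^ J" 1] z by (simp add: norm_power)
  also have "2 \<le> cmod (z - 1) * (real J / 2)"
    using far by (simp add: mult.commute)
  \<comment> \<open>Cancelling \<open>cmod (z - 1)\<close> is legitimate since \<open>far\<close>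
    excludes \<open>z = 1\<close>.\<close>
  finally show ?thesis
    by (rule mult_left_le_imp_le) (use far in \<open>cases "z = 1"; simp\<close>)
qed

section \<open>Coding sets of naturals injectively by points of the circle\<close>

definition tail_sum :: "(nat \<Rightarrow> real) \<Rightarrow> nat set \<Rightarrow> nat \<Rightarrow> real" where
  "tail_sum w A p = (\<Sum>l. indicator A (l + p) * w (l + p))"

context
  fixes w :: "nat \<Rightarrow> real"
  assumes pos: "\<And>p. 0 < w p" and decay: "\<And>p. w (Suc p) \<le> w p / 4"
begin

lemma weight_le: "w (l + p) \<le> w p * (1 / 4) ^ l"
proof (induction l)
  case (Suc l)
  then show ?case using decay[of "l + p"] by simp
qed simp

lemma summable_tail: "summable (\<lambda>l. indicator A (l + p) * w (l + p))"
proof (rule summable_comparison_test')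
  show "summable (\<lambda>l. w p * (1 / 4) ^ l)" by (simp add: summable_mult)
  show "norm (indicator A (l + p) * w (l + p)) \<le> w p * (1 / 4) ^ l" for l
    using weight_le[of l p] pos[of "l + p"] by (cases "l + p \<in> A") auto
qed

lemma tail_sum_nonneg: "0 \<le> tail_sum w A p"
  unfolding tail_sum_def using pos by (intro suminf_nonneg summable_tail) (simp add: less_imp_le)

lemma tail_sum_le: "tail_sum w A p \<le> 4 / 3 * w p"
proof -
  have "tail_sum w A p \<le> (\<Sum>l. w p * (1 / 4) ^ l)"
    unfolding tail_sum_def
  proof (rule suminf_le)
    show "indicator A (l + p) * w (l + p) \<le> w p * (1 / 4) ^ l" for l
      using weight_le[of l p] pos[of "l + p"] by (cases "l + p \<in> A") auto
  qed (simp_all add: summable_tail summable_mult)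
  then show ?thesis by (simp add: suminf_mult suminf_geometric)
qed

lemma tail_sum_Suc: "tail_sum w A p = indicator A p * w p + tail_sum w A (Suc p)"
  using suminf_split_head[OF summable_tail[of A p]] by (simp add: tail_sum_def)

text \<open>All weights after \<open>p\<close> together amount to at most a third of
  \<open>w p\<close>, so they cannot make up for a disagreement at \<open>p\<close>. Iterating
  recovers the set digit by digit.\<close>

lemma tail_sum_step:
  assumes "tail_sum w A p = tail_sum w B p"
  shows "(p \<in> A \<longleftrightarrow> p \<in> B) \<and> tail_sum w A (Suc p) = tail_sum w B (Suc p)"
proof -
  have "tail_sum w C (Suc p) < w p" for C
    using tail_sum_le[of C "Suc p"] decay[of p] pos[of p] by simp
  from this[of A] this[of B] show ?thesis
    using assms tail_sum_nonneg[of A "Suc p"] tail_sum_nonneg[of B "Suc p"]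
      tail_sum_Suc[of A p] tail_sum_Suc[of B p]
    by (cases "p \<in> A"; cases "p \<in> B") auto
qed

lemma inj_tail_sum: "inj (\<lambda>A. tail_sum w A 0)"
proof (rule injI)
  fix A B assume eq: "tail_sum w A 0 = tail_sum w B 0"
  have "tail_sum w A p = tail_sum w B p" for p
    by (induction p) (use eq tail_sum_step in blast)+
  then show "A = B" using tail_sum_step by blast
qed

end

lemma inj_on_cis_2pi: "inj_on (\<lambda>x. cis (2 * pi * x)) {0..<1}"
proof (rule inj_onI)
  fix x y :: real
  assume xy: "x \<in> {0..<1}" "y \<in> {0..<1}" and "cis (2 * pi * x) = cis (2 * pi * y)"
  then obtain n :: int where "2 * pi * x = 2 * pi * y + 2 * pi * n"
    using sin_cos_eq_iff[of "2 * pi * x" "2 * pi * y"] by (auto simp: complex_eq_iff)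
  then have "2 * pi * x = 2 * pi * (y + n)" by (simp add: algebra_simps)
  then have "x = y + n" by simp
  then show "x = y" using xy by auto
qed

lemma cmod_cis_minus_1_le: "cmod (cis x - 1) \<le> \<bar>x\<bar>"
  using dist_exp_i_1[of x] abs_sin_x_le_abs_x[of "x / 2"] by (simp add: cis_conv_exp)

lemma uncountable_range_nat_set:
  fixes f :: "nat set \<Rightarrow> 'a"
  assumes "inj f"
  shows "uncountable (range f)"
proof
  assume "countable (range f)"
  then have "countable (UNIV :: nat set set)" using assms countable_image_inj_eq by blast
  then have "range (from_nat_into (UNIV :: nat set set)) = Pow UNIV"
    by (simp add: range_from_nat_into)
  then show False using Cantors_theorem by blast
qed

section \<open>The sequence and its block structure\<close>

text \<open>In the notation of the introduction, \<open>block_length\<close>, \<open>ratio\<close> and \<open>block_scale\<close> are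
  \<open>r\<close>, \<open>t\<close> and \<open>q\<close>.\<close>

definition block_length :: "nat \<Rightarrow> nat" where
  "block_length p = 32 * 2 ^ p"

definition ratio :: "nat \<Rightarrow> nat" where
  "ratio p = 64 * 4 ^ p"

definition block_scale :: "nat \<Rightarrow> nat" where
  "block_scale p = (\<Prod>l<p. ratio l)"

definition block :: "nat \<Rightarrow> nat set" where
  "block p = (*) (block_scale p) ` {1..block_length p}"

text \<open>The sequence is the increasing enumeration of this set, written
  \<open>enumerate blocks (k - 1)\<close> because its indices start at 1.\<close>

definition blocks :: "nat set" where
  "blocks = (\<Union>p. block p)"

lemma ratio_conv_square: "ratio p = 64 * (2 ^ p * 2 ^ p)"
  by (simp add: ratio_def flip: power_mult_distrib)

lemma ratio_ge: "64 \<le> ratio p"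
  by (simp add: ratio_def)

lemma block_scale_Suc: "block_scale (Suc p) = ratio p * block_scale p"
  by (simp add: block_scale_def)

lemma block_scale_pos: "0 < block_scale p"
  by (simp add: block_scale_def ratio_def)

lemma strict_mono_block_scale: "strict_mono block_scale"
proof (rule strict_monoI_Suc)
  show "block_scale p < block_scale (Suc p)" for p
    using block_scale_pos[of p] ratio_ge[of p] by (simp add: block_scale_Suc)
qed

text \<open>With r the block length, the sum is r(r+1)/2, more than r^2/2, which is 8 times the
  ratio r^2/16.\<close>

lemma less_8_ratio_imp_le_sum: "j < 8 * ratio p \<Longrightarrow> j \<le> \<Sum>{1..block_length p}"
proof -
  have "\<Sum>{1..block_length p} = 512 * (2 ^ p * 2 ^ p) + 16 * 2 ^ p"
    using gauss_sum_nat[of "block_length p"]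
    by (simp add: block_length_def sum.atLeast_Suc_atMost algebra_simps)
  then show "j < 8 * ratio p \<Longrightarrow> j \<le> \<Sum>{1..block_length p}" by (simp add: ratio_conv_square)
qed

text \<open>The block is shorter than the ratio, so its last multiple stays below the next scale;
  this separates the blocks.\<close>

lemma block_subset: "block p \<subseteq> {block_scale p..<block_scale (Suc p)}"
proof -
  have "block_length p < ratio p"
    using one_less_power[of "2 :: nat" "Suc p"] by (simp add: block_length_def ratio_conv_square)
  then have "i \<le> block_length p \<Longrightarrow> block_scale p * i < block_scale p * ratio p" for i
    using block_scale_pos[of p] by simp
  then show ?thesis by (auto simp: block_def block_scale_Suc mult.commute[of "ratio p"])
qed

lemma disjoint_block_scale_intervals:
  assumes "p \<noteq> q"
  shows "{block_scale p..<block_scale (Suc p)} \<inter> {block_scale q..<block_scale (Suc q)} = {}"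
proof -
  have "{block_scale p..<block_scale (Suc p)} \<inter> {block_scale q..<block_scale (Suc q)} = {}" if "p < q" for p q
    using strict_mono_less_eq[OF strict_mono_block_scale, of "Suc p" q] that by auto
  then show ?thesis using assms by (metis Int_commute linorder_neqE_nat)
qed

lemma infinite_blocks: "infinite blocks"
proof -
  have "block_scale p \<in> block p" for p
    unfolding block_def by (rule image_eqI[of _ _ 1]) (auto simp: block_length_def)
  then have "range block_scale \<subseteq> blocks" by (auto simp: blocks_def)
  then show ?thesis
    using strict_mono_imp_inj_on[OF strict_mono_block_scale] finite_subset range_inj_infinite by blast
qed

section \<open>Uncountably many points of G2\<close>

definition weight :: "nat \<Rightarrow> real" where
  "weight p = 1 / block_scale (Suc p)"

lemma weight_pos: "0 < weight p"
  by (simp add: weight_def block_scale_pos)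

lemma weight_Suc_le: "weight (Suc p) \<le> weight p / 4"
proof -
  have "4 * block_scale (Suc p) \<le> block_scale (Suc (Suc p))"
    using ratio_ge[of "Suc p"] by (simp add: block_scale_Suc[of "Suc p"])
  then have "4 * real (block_scale (Suc p)) \<le> real (block_scale (Suc (Suc p)))"
    by (metis of_nat_le_iff of_nat_mult of_nat_numeral)
  then show ?thesis
    using block_scale_pos[of "Suc p"] block_scale_pos[of "Suc (Suc p)"]
    by (simp add: weight_def field_simps)
qed

definition point :: "nat set \<Rightarrow> complex" where
  "point A = cis (2 * pi * tail_sum weight A 0)"

lemma inj_point: "inj point"
proof -
  have "tail_sum weight A 0 \<in> {0..<1}" for A
    using tail_sum_nonneg[of weight A 0] tail_sum_le[of weight A 0] weight_pos weight_Suc_le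
    by (simp add: weight_def block_scale_def ratio_def)
  then show ?thesis
    using inj_on_cis_2pi inj_tail_sum[of weight, OF weight_pos weight_Suc_le]
    unfolding point_def by (auto simp: inj_on_def)
qed

text \<open>For l < p the scale at \<open>p\<close> is a multiple of the scale at l+1, so the terms
  before \<open>p\<close> become whole turns and only the tail remains.\<close>

lemma point_power_block_scale: "point A ^ block_scale p = cis (2 * pi * (block_scale p * tail_sum weight A p))"
proof (induction p)
  case 0
  then show ?case by (simp add: point_def block_scale_def)
next
  case (Suc p)
  have "real (block_scale (Suc p)) * tail_sum weight A p
      = indicator A p + block_scale (Suc p) * tail_sum weight A (Suc p)"
    using tail_sum_Suc[of weight, OF weight_pos weight_Suc_le, of A p] block_scale_pos[of "Suc p"]
    by (simp add: weight_def algebra_simps)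
  moreover have "point A ^ block_scale (Suc p) = cis (2 * pi * (block_scale (Suc p) * tail_sum weight A p))"
    by (simp add: block_scale_Suc mult.commute[of "ratio p"] power_mult Suc.IH Complex.DeMoivre)
      (simp add: mult_ac)
  ultimately show ?case
    by (simp add: distrib_left indicator_def flip: cis_mult)
qed

lemma cmod_point_power_block_scale: "cmod (point A ^ block_scale p - 1) \<le> 11 / ratio p"
proof -
  have "cmod (point A ^ block_scale p - 1) \<le> 2 * pi * (block_scale p * tail_sum weight A p)"
    using cmod_cis_minus_1_le[of "2 * pi * (block_scale p * tail_sum weight A p)"]
      tail_sum_nonneg[of weight A p] weight_pos weight_Suc_le
    by (simp add: point_power_block_scale)
  \<comment> \<open>Here pi is bounded by 4; the resulting 32/3 is rounded up to 11.\<close>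
  also have "\<dots> \<le> 2 * 4 * (block_scale p * (4 / 3 * weight p))"
    using tail_sum_le[of weight A p] tail_sum_nonneg[of weight A p] weight_pos weight_Suc_le pi_less_4
    by (intro mult_mono) auto
  also have "\<dots> = 32 / 3 / ratio p"
    using block_scale_pos[of p] by (simp add: weight_def block_scale_Suc field_simps)
  also have "\<dots> \<le> 11 / ratio p"
    by (intro divide_right_mono) auto
  finally show ?thesis .
qed

lemma sum_block_le:
  "(\<Sum>m\<in>block p. (cmod (point A ^ m - 1))\<^sup>2) \<le> 968 * (1 / 2) ^ p"
proof -
  have norm: "cmod (point A ^ m) = 1" for m by (simp add: point_def norm_power)
  have "(\<Sum>m\<in>block p. (cmod (point A ^ m - 1))\<^sup>2)
      = (\<Sum>i=1..block_length p. (cmod (point A ^ (block_scale p * i) - 1))\<^sup>2)"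
    unfolding block_def using block_scale_pos[of p] by (subst sum.reindex) (auto simp: inj_on_def)
  also have "\<dots> \<le> (\<Sum>i=1..block_length p. (real (block_length p) * (11 / ratio p))\<^sup>2)"
  proof (intro sum_mono power_mono)
    fix i assume i: "i \<in> {1..block_length p}"
    have "cmod (point A ^ (block_scale p * i) - 1) \<le> real i * cmod (point A ^ block_scale p - 1)"
      using norm_power_diff[of "point A ^ block_scale p" 1 i] norm by (simp add: power_mult)
    also have "\<dots> \<le> real (block_length p) * (11 / ratio p)"
      using i cmod_point_power_block_scale by (intro mult_mono) auto
    finally show "cmod (point A ^ (block_scale p * i) - 1) \<le> real (block_length p) * (11 / ratio p)" .
  qed simp
  \<comment> \<open>With block length r and ratio t = r^2/16, the sum 121 r^3 / t^2 is 121 * 256 /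
    r.\<close>
  also have "\<dots> = 968 * (1 / 2) ^ p"
    by (simp add: block_length_def ratio_conv_square field_simps power2_eq_square)
  finally show ?thesis .
qed

text \<open>Finitely many terms of the enumeration meet only finitely many of the sets, so
  \<open>suminf B\<close> bounds all partial sums.\<close>

lemma summable_enumerate_Union:
  fixes f B :: "nat \<Rightarrow> real" and b :: "nat \<Rightarrow> nat set"
  assumes f: "\<And>m. 0 \<le> f m" and fin: "\<And>p. finite (b p)"
    and disj: "\<And>p q. p \<noteq> q \<Longrightarrow> b p \<inter> b q = {}"
    and le: "\<And>p. sum f (b p) \<le> B p" and B: "summable B"
    and S: "infinite (\<Union>p. b p)"
  shows "summable (\<lambda>k. f (enumerate (\<Union>p. b p) k))"
proof (rule summableI_nonneg_bounded)
  fix K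
  let ?e = "enumerate (\<Union>p. b p)"
  have "\<forall>k. \<exists>p. ?e k \<in> b p" using enumerate_in_set[OF S] by auto
  then obtain g where g: "?e k \<in> b (g k)" for k by metis
  obtain N where N: "\<And>k. k < K \<Longrightarrow> g k < N"
    using finite_nat_set_iff_bounded[of "g ` {..<K}"] by auto
  have "(\<Sum>k<K. f (?e k)) = sum f (?e ` {..<K})"
    using inj_enumerate[OF S] by (subst sum.reindex) (auto intro: inj_on_subset)
  also have "\<dots> \<le> sum f (\<Union>p<N. b p)"
    using g N f fin by (intro sum_mono2) auto
  also have "\<dots> = (\<Sum>p<N. sum f (b p))"
    using fin disj by (intro sum.UNION_disjoint) auto
  also have "\<dots> \<le> (\<Sum>p<N. B p)" by (intro sum_mono le)
  also have "\<dots> \<le> suminf B"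
  proof (rule sum_le_suminf[OF B])
    show "0 \<le> B p" for p
      using f by (intro order_trans[OF _ le] sum_nonneg)
  qed simp
  finally show "(\<Sum>k<K. f (?e k)) \<le> suminf B" .
qed (rule f)

lemma point_in_G2: "point A \<in> G2 (\<lambda>k. enumerate blocks (k - 1))"
proof -
  have "summable (\<lambda>k. (cmod (point A ^ enumerate (\<Union>p. block p) k - 1))\<^sup>2)"
  proof (rule summable_enumerate_Union[OF _ _ _ sum_block_le])
    show "block p \<inter> block q = {}" if "p \<noteq> q" for p q
      using disjoint_block_scale_intervals[OF that] block_subset[of p] block_subset[of q] by blast
    show "infinite (\<Union>p. block p)" using infinite_blocks by (simp add: blocks_def)
    show "summable (\<lambda>p. 968 * (1 / 2) ^ p :: real)" by (simp add: summable_mult)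
  qed (auto simp: block_def)
  \<comment> \<open>\<open>G2\<close> evaluates the sequence at \<open>Suc k\<close>, which cancels
    the shift \<open>k - 1\<close>.\<close>
  then show ?thesis by (simp add: G2_def blocks_def point_def)
qed

section \<open>Measures on the circle and averaging of Fourier coefficients\<close>

lemma circle_prob_sets:
  assumes "circle_prob \<mu>" "B \<in> sets borel"
  shows "{z \<in> unit_circle. z \<in> B} \<in> sets \<mu>"
proof -
  have "sets \<mu> = (\<inter>) unit_circle ` sets borel"
    using assms by (simp add: circle_prob_def sets_restrict_space)
  moreover have "{z \<in> unit_circle. z \<in> B} = unit_circle \<inter> B" by blast
  ultimately show ?thesis using assms(2) by (simp only: imageI)
qed

lemma circle_prob_space:
  assumes "circle_prob \<mu>"
  shows "space \<mu> = unit_circle"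
proof -
  have "sets \<mu> = sets (restrict_space borel unit_circle)"
    using assms by (simp add: circle_prob_def)
  from sets_eq_imp_space_eq[OF this] show ?thesis by (simp add: space_restrict_space)
qed

lemma circle_prob_integrable:
  fixes f :: "complex \<Rightarrow> complex"
  assumes \<mu>: "circle_prob \<mu>" and f: "continuous_on UNIV f"
  shows "integrable \<mu> f"
proof -
  interpret prob_space \<mu> using \<mu> by (simp add: circle_prob_def)
  have "compact (f ` unit_circle)"
    using f by (intro compact_continuous_image) (auto intro: continuous_on_subset)
  then obtain B where "\<And>z. z \<in> unit_circle \<Longrightarrow> norm (f z) \<le> B"
    by (meson bounded_iff compact_imp_bounded imageI)
  moreover have "f \<in> borel_measurable \<mu>"
    using \<mu> borel_measurable_continuous_onI[OF f]
    by (simp add: circle_prob_def measurable_restrict_space1 cong: measurable_cong_sets)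
  ultimately show ?thesis
    using \<mu> by (intro integrable_const_bound[of _ B] AE_I2) (auto simp: circle_prob_space)
qed

text \<open>The bound is uniform in the finite set \<open>I\<close>, so it will survive a limit over
  infinitely many scales.\<close>

lemma measure_far_le:
  fixes q J :: "nat \<Rightarrow> nat"
  assumes \<mu>: "circle_prob \<mu>" and I: "finite I" and J: "\<And>p. p \<in> I \<Longrightarrow> 0 < J p"
    and coeff: "\<And>j. j \<in> (\<Pi>\<^sub>E p\<in>I. {..<J p}) \<Longrightarrow>
      cmod (fourier_coeff \<mu> (int (\<Sum>p\<in>I. q p * j p)) - 1) \<le> \<epsilon>"
  shows "measure \<mu> {z \<in> unit_circle. \<exists>p\<in>I. 4 \<le> real (J p) * cmod (z ^ q p - 1)} \<le> 2 * \<epsilon>"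
proof -
  interpret prob_space \<mu> using \<mu> by (simp add: circle_prob_def)
  \<comment> \<open>\<open>D z\<close> expands into one monomial for each choice function \<open>j\<close>, so its integral is within
    \<open>c \<epsilon>\<close> of \<open>c\<close>; but \<open>\<bar>D z\<bar> \<le> c\<close> everywhere and \<open>\<bar>D z\<bar> \<le> c / 2\<close> on \<open>A\<close>.\<close>
  define E where "E = (\<Pi>\<^sub>E p\<in>I. {..<J p})"
  define D where "D z = (\<Prod>p\<in>I. \<Sum>j<J p. (z ^ q p) ^ j)" for z :: complex
  define c where "c = (\<Prod>p\<in>I. real (J p))"
  define A where "A = {z \<in> unit_circle. \<exists>p\<in>I. 4 \<le> real (J p) * cmod (z ^ q p - 1)}"
  have c: "c > 0" using J unfolding c_def by (intro prod_pos) auto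
  have card: "real (card E) = c" using I by (simp add: E_def c_def card_PiE)
  have D: "D z = (\<Sum>g\<in>E. z powi int (\<Sum>p\<in>I. q p * g p))" for z
    using I unfolding D_def E_def
    by (subst prod_sum_PiE) (simp_all add: power_sum power_mult del: of_nat_sum)
  have int: "integrable \<mu> (\<lambda>z. z powi int m)" for m
    using \<mu> by (intro circle_prob_integrable) (auto intro!: continuous_intros)
  have "closed {z :: complex. \<exists>p\<in>I. 4 \<le> real (J p) * cmod (z ^ q p - 1)}"
    using I unfolding Collect_bex_eq
    by (intro closed_UN closed_Collect_le continuous_intros ballI)
  from circle_prob_sets[OF \<mu> borel_closed[OF this]] have A: "A \<in> sets \<mu>"
    by (simp add: A_def)
  have bound: "cmod (D z) \<le> c * (1 - indicator A z / 2)" if z: "z \<in> unit_circle" for z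
  proof -
    have norm: "cmod (z ^ m) = 1" for m using z by (simp add: norm_power)
    have le: "cmod (\<Sum>j<J p. (z ^ q p) ^ j) \<le> real (J p)" for p
      using sum_norm_le[of "{..<J p}" "\<lambda>j. (z ^ q p) ^ j" "\<lambda>_. 1"] norm by (simp add: norm_power)
    show ?thesis
    proof (cases "z \<in> A")
      case False
      then show ?thesis
        unfolding D_def c_def using le by (simp add: prod_norm[symmetric] prod_mono)
    next
      case True
      then obtain p where p: "p \<in> I" "4 \<le> real (J p) * cmod (z ^ q p - 1)"
        by (auto simp: A_def)
      \<comment> \<open>One far scale halves its own factor; the others are bounded by their numbers
        of terms.\<close>
      have "cmod (D z) = cmod (\<Sum>j<J p. (z ^ q p) ^ j) * (\<Prod>p\<in>I-{p}. cmod (\<Sum>j<J p. (z ^ q p) ^ j))"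
        using p I by (simp add: D_def prod.remove norm_mult flip: prod_norm)
      also have "\<dots> \<le> (real (J p) / 2) * (\<Prod>p\<in>I-{p}. real (J p))"
        using le p norm by (intro mult_mono prod_mono cmod_geometric_sum_le prod_nonneg) auto
      also have "\<dots> = c / 2" using p I by (simp add: c_def prod.remove)
      finally show ?thesis using True by simp
    qed
  qed
  have "(\<integral>z. D z \<partial>\<mu>) = (\<Sum>g\<in>E. fourier_coeff \<mu> (int (\<Sum>p\<in>I. q p * g p)))"
    unfolding D fourier_coeff_def by (rule Bochner_Integration.integral_sum[OF int])
  then have "cmod ((\<integral>z. D z \<partial>\<mu>) - c) \<le> (\<Sum>g\<in>E. \<epsilon>)"
    using sum_norm_le[of E "\<lambda>g. fourier_coeff \<mu> (int (\<Sum>p\<in>I. q p * g p)) - 1" "\<lambda>_. \<epsilon>"] coeff card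
    by (simp add: E_def sum_subtractf flip: card)
  then have lower: "c - cmod (\<integral>z. D z \<partial>\<mu>) \<le> c * \<epsilon>"
    using norm_triangle_ineq2[of "of_real c" "\<integral>z. D z \<partial>\<mu>"] c card
    by (simp add: norm_minus_commute)
  have ind: "integrable \<mu> (indicator A :: complex \<Rightarrow> real)"
    using A by (intro integrable_real_indicator) (auto simp: emeasure_eq_measure)
  have "cmod (\<integral>z. D z \<partial>\<mu>) \<le> (\<integral>z. c * (1 - indicator A z / 2) \<partial>\<mu>)"
  proof (rule Bochner_Integration.integral_norm_bound_integral)
    show "integrable \<mu> D" unfolding D by (rule Bochner_Integration.integrable_sum[OF int])
    show "integrable \<mu> (\<lambda>z. c * (1 - indicator A z / 2))"
      using ind by (intro integrable_mult_right Bochner_Integration.integrable_diff) auto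
    show "cmod (D z) \<le> c * (1 - indicator A z / 2)" if "z \<in> space \<mu>" for z
      using bound that by (simp add: circle_prob_space[OF \<mu>])
  qed
  moreover have "(\<integral>z. c * (1 - indicator A z / 2) \<partial>\<mu>) = c * (1 - measure \<mu> A / 2)"
    using A ind by (simp add: prob_space)
  ultimately have "c * (measure \<mu> A / 2) \<le> c * \<epsilon>" using lower by (simp add: algebra_simps)
  then show ?thesis using c by (simp add: A_def)
qed

text \<open>Passes from index sets to sets of values: large elements of \<open>S\<close> have large
  indices.\<close>

lemma IP_Dirichlet_enumerateD:
  assumes \<mu>: "circle_prob \<mu>" and S: "infinite S"
    and IP: "IP_Dirichlet (\<lambda>k. enumerate S (k - 1)) \<mu>" and \<epsilon>: "0 < \<epsilon>"
  obtains M where "\<And>G. finite G \<Longrightarrow> G \<subseteq> S \<Longrightarrow> (\<And>m. m \<in> G \<Longrightarrow> M \<le> m) \<Longrightarrow>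
    cmod (fourier_coeff \<mu> (int (\<Sum>G)) - 1) < \<epsilon>"
proof -
  interpret prob_space \<mu> using \<mu> by (simp add: circle_prob_def)
  obtain k\<^sub>0 where k\<^sub>0: "\<And>F. finite F \<Longrightarrow> F \<noteq> {} \<Longrightarrow> F \<subseteq> {1..} \<Longrightarrow> Min F \<ge> k\<^sub>0 \<Longrightarrow>
      cmod (fourier_coeff \<mu> (int (\<Sum>k\<in>F. enumerate S (k - 1))) - 1) < \<epsilon>"
    using IP \<epsilon> unfolding IP_Dirichlet_def by meson
  show thesis
  proof (rule that[of "enumerate S k\<^sub>0"])
    fix G assume G: "finite G" "G \<subseteq> S" "\<And>m. m \<in> G \<Longrightarrow> enumerate S k\<^sub>0 \<le> m"
    show "cmod (fourier_coeff \<mu> (int (\<Sum>G)) - 1) < \<epsilon>"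
    proof (cases "G = {}")
      \<comment> \<open>The empty sum gives the coefficient at 0, the total mass 1. It is needed
        when every chosen multiplier is 0.\<close>
      case True
      then show ?thesis using \<epsilon> by (simp add: fourier_coeff_def prob_space)
    next
      case False
      define L where "L = enumerate S -` G"
      have img: "enumerate S ` L = G" using G range_enumerate[OF S] by (auto simp: L_def)
      have inj: "inj (enumerate S)" using inj_enumerate[OF S] by auto
      have "finite L" unfolding L_def using G inj by (intro finite_vimageI) auto
      moreover have "k\<^sub>0 \<le> l" if "l \<in> L" for l
      proof -
        have "enumerate S k\<^sub>0 \<le> enumerate S l" using G(3) that by (simp add: L_def)
        then show ?thesis by (meson S enumerate_mono leD leI)
      qed
      moreover have "L \<noteq> {}" using img False by auto
      \<comment> \<open>\<open>Suc\<close> turns positions of the enumeration, counted from 0, into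
        indices of the sequence.\<close>
      ultimately have "cmod (fourier_coeff \<mu> (int (\<Sum>k\<in>Suc ` L. enumerate S (k - 1))) - 1) < \<epsilon>"
        by (intro k\<^sub>0) (auto simp: le_SucI)
      moreover have "(\<Sum>k\<in>Suc ` L. enumerate S (k - 1)) = \<Sum>(enumerate S ` L)"
        using inj by (simp add: sum.reindex inj_on_subset)
      ultimately show ?thesis by (simp only: img)
    qed
  qed
qed

section \<open>No continuous measure is IP-Dirichlet for the sequence\<close>

lemma eq_1_if_close:
  assumes z: "cmod z = 1" and close: "\<And>p. P \<le> p \<Longrightarrow> 8 * real (ratio p) * cmod (z ^ block_scale p - 1) < 4"
  shows "z ^ block_scale P = 1"
proof (rule ccontr)
  assume "z ^ block_scale P \<noteq> 1"
  then have d: "0 < cmod (z ^ block_scale P - 1)" by simp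
  have norm: "cmod (z ^ m) = 1" for m using z by (simp add: norm_power)
  \<comment> \<open>Each step gains at least half the ratio, hence more than 2, whereas distances on
    the circle never exceed 2.\<close>
  have "2 ^ n * cmod (z ^ block_scale P - 1) \<le> cmod (z ^ block_scale (P + n) - 1)" for n
  proof (induction n)
    case (Suc n)
    let ?p = "P + n"
    have "2 * cmod (z ^ block_scale ?p - 1) \<le> real (ratio ?p) / 2 * cmod (z ^ block_scale ?p - 1)"
      using ratio_ge[of ?p] by (intro mult_right_mono) auto
    also have "\<dots> \<le> cmod ((z ^ block_scale ?p) ^ ratio ?p - 1)"
      using close[of ?p] ratio_ge[of ?p]
      by (intro cmod_power_minus_1_ge norm) (auto simp: field_simps)
    also have "(z ^ block_scale ?p) ^ ratio ?p = z ^ block_scale (P + Suc n)"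
      by (simp add: block_scale_Suc mult.commute flip: power_mult)
    finally show ?case using Suc.IH by simp
  qed simp
  moreover have "cmod (z ^ m - 1) \<le> 2" for m
    using norm_triangle_ineq4[of "z ^ m" 1] norm[of m] by simp
  ultimately have "2 ^ n * cmod (z ^ block_scale P - 1) \<le> 2" for n
    using order_trans by blast
  moreover obtain n where "2 / cmod (z ^ block_scale P - 1) < 2 ^ n"
    using real_arch_pow[of 2] by auto
  ultimately show False using d by (simp add: field_simps) (meson not_le)
qed

lemma not_IP_Dirichlet_blocks:
  assumes \<mu>: "circle_prob \<mu>" and cont: "continuous_measure \<mu>"
  shows "\<not> IP_Dirichlet (\<lambda>k. enumerate blocks (k - 1)) \<mu>"
proof
  assume "IP_Dirichlet (\<lambda>k. enumerate blocks (k - 1)) \<mu>"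
  \<comment> \<open>\<open>P\<close> bounds elements, yet also serves as the first block index:
    elements of block p are at least the scale at p, hence at least p. The value 1/8 will leave far
    sets of measure at most 1/4.\<close>
  then obtain P where P: "\<And>G. finite G \<Longrightarrow> G \<subseteq> blocks \<Longrightarrow> (\<And>m. m \<in> G \<Longrightarrow> P \<le> m) \<Longrightarrow>
      cmod (fourier_coeff \<mu> (int (\<Sum>G)) - 1) < 1 / 8"
    using IP_Dirichlet_enumerateD[OF \<mu> infinite_blocks, of "1 / 8"] by auto
  interpret prob_space \<mu> using \<mu> by (simp add: circle_prob_def)
  define A where "A N = {z \<in> unit_circle. \<exists>p\<in>{P..<N}. 4 \<le> real (8 * ratio p) * cmod (z ^ block_scale p - 1)}" for N
  have "closed {z :: complex. \<exists>p\<in>{P..<N}. 4 \<le> real (8 * ratio p) * cmod (z ^ block_scale p - 1)}" for N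
    unfolding Collect_bex_eq by (intro closed_UN closed_Collect_le continuous_intros ballI) simp
  from circle_prob_sets[OF \<mu> borel_closed[OF this]] have A: "A N \<in> sets \<mu>" for N
    by (simp add: A_def)
  have "measure \<mu> (A N) \<le> 2 * (1 / 8)" for N
    unfolding A_def
  proof (rule measure_far_le[OF \<mu>])
    fix j assume j: "j \<in> (\<Pi>\<^sub>E p\<in>{P..<N}. {..<8 * ratio p})"
    \<comment> \<open>Writing each \<open>j p\<close> as a subset sum makes the exponent a sum of
      distinct elements of \<open>blocks\<close>.\<close>
    have "\<forall>p\<in>{P..<N}. \<exists>F\<subseteq>{1..block_length p}. \<Sum>F = j p"
      using j by (intro ballI subset_sum_atLeastAtMost less_8_ratio_imp_le_sum) auto
    then obtain F where F: "\<And>p. p \<in> {P..<N} \<Longrightarrow> F p \<subseteq> {1..block_length p}"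
        "\<And>p. p \<in> {P..<N} \<Longrightarrow> \<Sum>(F p) = j p"
      by metis
    define b where "b p = (*) (block_scale p) ` F p" for p
    have b: "b p \<subseteq> block p" if "p \<in> {P..<N}" for p
      using F(1)[OF that] by (auto simp: b_def block_def)
    have fin: "finite (b p)" if "p \<in> {P..<N}" for p
      using finite_subset[OF F(1)[OF that]] by (simp add: b_def)
    have "\<Sum>(\<Union>p\<in>{P..<N}. b p) = (\<Sum>p\<in>{P..<N}. \<Sum>(b p))"
    proof (rule sum.UNION_disjoint)
      show "\<forall>p\<in>{P..<N}. \<forall>q\<in>{P..<N}. p \<noteq> q \<longrightarrow> b p \<inter> b q = {}"
        using b block_subset disjoint_block_scale_intervals by blast
    qed (use fin in auto)
    also have "\<dots> = (\<Sum>p\<in>{P..<N}. block_scale p * j p)"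
    proof (rule sum.cong)
      fix p assume p: "p \<in> {P..<N}"
      have "\<Sum>(b p) = (\<Sum>i\<in>F p. block_scale p * i)"
        unfolding b_def using block_scale_pos[of p] by (subst sum.reindex) (auto simp: inj_on_def)
      then show "\<Sum>(b p) = block_scale p * j p"
        using F(2)[OF p] by (simp flip: sum_distrib_left)
    qed simp
    finally have sum: "\<Sum>(\<Union>p\<in>{P..<N}. b p) = (\<Sum>p\<in>{P..<N}. block_scale p * j p)" .
    have "cmod (fourier_coeff \<mu> (int (\<Sum>(\<Union>p\<in>{P..<N}. b p))) - 1) < 1 / 8"
    proof (rule P)
      show "(\<Union>p\<in>{P..<N}. b p) \<subseteq> blocks" using b unfolding blocks_def by blast
      show "P \<le> m" if m: "m \<in> (\<Union>p\<in>{P..<N}. b p)" for m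
      proof -
        obtain p where p: "p \<in> {P..<N}" "m \<in> b p" using m by blast
        then have "P \<le> p" "m \<in> block p" using b[OF p(1)] by auto
        then show ?thesis
          using block_subset[of p] strict_mono_imp_increasing[OF strict_mono_block_scale, of p] by auto
      qed
    qed (use fin in auto)
    then show "cmod (fourier_coeff \<mu> (int (\<Sum>p\<in>{P..<N}. block_scale p * j p)) - 1) \<le> 1 / 8"
      by (simp add: sum)
  qed (simp_all add: ratio_def)
  moreover have "(\<lambda>N. measure \<mu> (A N)) \<longlonglongrightarrow> measure \<mu> (\<Union>N. A N)"
    using A by (intro finite_Lim_measure_incseq) (auto simp: incseq_def A_def)
  ultimately have le: "measure \<mu> (\<Union>N. A N) \<le> 1 / 4"
    by (intro LIMSEQ_le_const2[where X = "\<lambda>N. measure \<mu> (A N)"]) auto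
  \<comment> \<open>Points close to 1 at all scales from \<open>P\<close> on end up in this finite
    set, which is null because there are no atoms.\<close>
  define R where "R = {z \<in> unit_circle. z ^ block_scale P = 1}"
  have fin: "finite R"
  proof (rule finite_subset)
    show "finite {z :: complex. z ^ block_scale P = 1}"
      using block_scale_pos[of P] by (intro finite_roots_unity) simp
  qed (auto simp: R_def)
  have sing: "{z} \<in> sets \<mu>" if "z \<in> R" for z
  proof -
    have "{z} = {y \<in> unit_circle. y \<in> {z}}" using that by (auto simp: R_def)
    then show ?thesis using circle_prob_sets[OF \<mu>, of "{z}"] by simp
  qed
  have "measure \<mu> R = (\<Sum>z\<in>R. measure \<mu> {z})"
    using fin sing by (rule finite_measure_eq_sum_singleton)
  also have "\<dots> = 0"
    using cont by (simp add: continuous_measure_def measure_def circle_prob_space[OF \<mu>] R_def)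
  finally have R: "measure \<mu> R = 0" .
  have "R \<in> sets \<mu>" using fin sing sets.finite_UN[of R "\<lambda>z. {z}" \<mu>] by simp
  \<comment> \<open>A null set and a set of measure at most 1/4 thus cover a space of mass
    1.\<close>
  have "space \<mu> \<subseteq> R \<union> (\<Union>N. A N)"
  proof
    fix z assume "z \<in> space \<mu>"
    then have z: "cmod z = 1" by (simp add: circle_prob_space[OF \<mu>])
    show "z \<in> R \<union> (\<Union>N. A N)"
    proof (cases "\<exists>p\<ge>P. 4 \<le> 8 * real (ratio p) * cmod (z ^ block_scale p - 1)")
      case True
      then obtain p where "p \<ge> P" "4 \<le> 8 * real (ratio p) * cmod (z ^ block_scale p - 1)" by blast
      then have "z \<in> A (Suc p)" using z by (auto simp: A_def)
      then show ?thesis by blast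
    next
      case False
      then have "z ^ block_scale P = 1" by (intro eq_1_if_close[OF z]) (meson not_le)
      then show ?thesis using z by (simp add: R_def)
    qed
  qed
  then have "measure \<mu> (space \<mu>) \<le> measure \<mu> (R \<union> (\<Union>N. A N))"
    using A \<open>R \<in> sets \<mu>\<close> by (intro finite_measure_mono) auto
  also have "\<dots> \<le> measure \<mu> R + measure \<mu> (\<Union>N. A N)"
    using A \<open>R \<in> sets \<mu>\<close> by (intro measure_Un_le) auto
  finally show False using R le by (simp add: prob_space)
qed

theorem theorem1p5:
  shows "\<exists>n :: nat \<Rightarrow> nat. strict_mono_on {1..} n \<and> (\<forall>k\<ge>1. n k > 0) \<and>
    uncountable (G2 n) \<and>
    \<not> (\<exists>\<mu>. circle_prob \<mu> \<and> continuous_measure \<mu> \<and> IP_Dirichlet n \<mu>)"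
proof (intro exI[of _ "\<lambda>k. enumerate blocks (k - 1)"] conjI)
  show "strict_mono_on {1..} (\<lambda>k. enumerate blocks (k - 1))"
    by (auto intro!: strict_mono_onI enumerate_mono infinite_blocks)
  have "0 < m" if "m \<in> blocks" for m
    using that block_scale_pos by (auto simp: blocks_def block_def)
  then show "\<forall>k\<ge>1. 0 < enumerate blocks (k - 1)"
    using enumerate_in_set[OF infinite_blocks] by blast
  have "range point \<subseteq> G2 (\<lambda>k. enumerate blocks (k - 1))" using point_in_G2 by blast
  then show "uncountable (G2 (\<lambda>k. enumerate blocks (k - 1)))"
    using uncountable_range_nat_set[OF inj_point] countable_subset by blast
  show "\<not> (\<exists>\<mu>. circle_prob \<mu> \<and> continuous_measure \<mu> \<and>
      IP_Dirichlet (\<lambda>k. enumerate blocks (k - 1)) \<mu>)"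
    using not_IP_Dirichlet_blocks by blast
qed

end
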